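(* Let $(T,m)$ be a flow tree. Then there exists an approximating sequence of $(T,m)$ made of uniformly rational flow trees.
   Context: A tree $T$ is an infinite connected graph without cycles, locally finite, identified with its set of vertices. A tree with root at infinity is such a tree with a fixed boundary point (end) $\omega_*\in\partial T$. For $x\in T$, the predecessor $\mathfrak{p}(x)$ is the neighbour of $x$ lying on the semi-infinite geodesic from $x$ to $\omega_*$; the remaining neighbours form the set $\mathfrak{s}(x)$ of successors. A flow measure on $T$ is a function $m:T\to(0,\infty)$ with $m(x)=\sum_{y\in\mathfrak{s}(x)}m(y)$ for all $x$; $(T,m)$ is then a flow tree. A flow tree $(T,m)$ is uniformly rational if there exists a positive integer $q$ such that $q\,m(x)/m(\mathfrak{p}(x))$ is a positive integer for every $x\in T$. A $\mathfrak{p}$-subtree of $T$ is a subset $S\subseteq T$ such that $x\in S$ implies $\mathfrak{p}(x)\in S$; with the structure induced by $T$, $S$ is itself a tree with root at infinity. An approximating sequence for $(T,m)$ is a sequence $((T_j,m_j))_j$ such that: (a) the $T_j$ form an increasing sequence of $\mathfrak{p}$-subtrees of $T$, and $T=\bigcup_jT_j$; (b) each $m_j$ is a flow measure on $T_j$; (c) extending each $m_j$ by zeros to $T$, $m_j\to m$ pointwise on $T$. *)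

theory Defs
  imports Complex_Main "Graph_Theory.Digraph_Component"
begin

text \<open>
  An undirected simple graph is a symmetric digraph without loops and without multiple arcs.
  In such a digraph every edge, traversed back and forth, is a \<^const>\<open>pre_digraph.cycle\<close>
  of length 2; the cycles of the undirected graph are those of length at least 3.
\<close>

locale infinite_tree = sym_digraph + loopfree_digraph + nomulti_digraph +
  assumes tree_infinite: "infinite (verts G)"
    and tree_connected: "Digraph_Component.connected G"
    and tree_acyclic: "\<not> (\<exists>p. cycle p \<and> length p \<ge> 3)"
    and tree_locally_finite: "\<And>x. x \<in> verts G \<Longrightarrow> finite {y. x \<rightarrow> y}"

text \<open>
  In a tree the semi-infinite geodesics are the one-way infinite paths without repeated vertices.
  The boundary consists of the classes of such rays with a common tail.
\<close>

definition rays :: "('a, 'b) pre_digraph \<Rightarrow> (nat \<Rightarrow> 'a) set" where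
  "rays G = {r. inj r \<and> range r \<subseteq> verts G \<and> (\<forall>n. r n \<rightarrow>\<^bsub>G\<^esub> r (Suc n))}"

definition cofinal_rays :: "('a, 'b) pre_digraph \<Rightarrow> ((nat \<Rightarrow> 'a) \<times> (nat \<Rightarrow> 'a)) set" where
  "cofinal_rays G =
     {(r, s). r \<in> rays G \<and> s \<in> rays G \<and> (\<exists>k l. \<forall>n. r (k + n) = s (l + n))}"

definition boundary :: "('a, 'b) pre_digraph \<Rightarrow> (nat \<Rightarrow> 'a) set set" where
  "boundary G = rays G // cofinal_rays G"

locale tree_root_at_infinity = infinite_tree G
  for G :: "('a, 'b) pre_digraph" (structure) and \<omega> :: "(nat \<Rightarrow> 'a) set" +
  assumes root_in_boundary: "\<omega> \<in> boundary G"

text \<open>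
  The rays belonging to the class \<open>\<omega>\<close> and starting at \<open>x\<close> are the geodesics from \<open>x\<close> to \<open>\<omega>\<close>;
  in a tree there is exactly one for every vertex \<open>x\<close>, so the description below is proper.
\<close>

definition predecessor :: "(nat \<Rightarrow> 'a) set \<Rightarrow> 'a \<Rightarrow> 'a" where
  "predecessor \<omega> x = (THE y. \<exists>r\<in>\<omega>. r 0 = x \<and> r 1 = y)"

definition successors :: "('a, 'b) pre_digraph \<Rightarrow> (nat \<Rightarrow> 'a) set \<Rightarrow> 'a \<Rightarrow> 'a set" where
  "successors G \<omega> x = {y. x \<rightarrow>\<^bsub>G\<^esub> y} - {predecessor \<omega> x}"

definition flow_measure ::
    "('a, 'b) pre_digraph \<Rightarrow> (nat \<Rightarrow> 'a) set \<Rightarrow> ('a \<Rightarrow> real) \<Rightarrow> bool" where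
  "flow_measure G \<omega> m \<longleftrightarrow>
     (\<forall>x\<in>verts G. m x > 0) \<and> (\<forall>x\<in>verts G. m x = (\<Sum>y\<in>successors G \<omega> x. m y))"

locale flow_tree = tree_root_at_infinity G \<omega>
  for G :: "('a, 'b) pre_digraph" (structure) and \<omega> :: "(nat \<Rightarrow> 'a) set" +
  fixes m :: "'a \<Rightarrow> real"
  assumes flow: "flow_measure G \<omega> m"

definition uniformly_rational ::
    "('a, 'b) pre_digraph \<Rightarrow> (nat \<Rightarrow> 'a) set \<Rightarrow> ('a \<Rightarrow> real) \<Rightarrow> bool" where
  "uniformly_rational G \<omega> m \<longleftrightarrow>
     (\<exists>q::nat. q > 0 \<and>
        (\<forall>x\<in>verts G. \<exists>k::nat. k > 0 \<and> real q * m x / m (predecessor \<omega> x) = real k))"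

text \<open>
  Non-emptiness is part of the requirement that a \<open>\<pp>\<close>-subtree be a tree.
\<close>

definition p_subtree :: "('a, 'b) pre_digraph \<Rightarrow> (nat \<Rightarrow> 'a) set \<Rightarrow> 'a set \<Rightarrow> bool" where
  "p_subtree G \<omega> S \<longleftrightarrow> S \<subseteq> verts G \<and> S \<noteq> {} \<and> (\<forall>x\<in>S. predecessor \<omega> x \<in> S)"

text \<open>
  The structure induced on a \<open>\<pp>\<close>-subtree \<open>S\<close> is the induced subgraph \<open>G \<restriction> S\<close>, its root at
  infinity being the class of those rays to \<open>\<omega>\<close> that stay in \<open>S\<close>.
\<close>

definition induced_root :: "(nat \<Rightarrow> 'a) set \<Rightarrow> 'a set \<Rightarrow> (nat \<Rightarrow> 'a) set" where
  "induced_root \<omega> S = {r \<in> \<omega>. range r \<subseteq> S}"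

definition approximating_sequence ::
    "('a, 'b) pre_digraph \<Rightarrow> (nat \<Rightarrow> 'a) set \<Rightarrow> ('a \<Rightarrow> real) \<Rightarrow>
     (nat \<Rightarrow> 'a set) \<Rightarrow> (nat \<Rightarrow> 'a \<Rightarrow> real) \<Rightarrow> bool" where
  "approximating_sequence G \<omega> m T \<mu> \<longleftrightarrow>
     (\<forall>j. p_subtree G \<omega> (T j)) \<and> incseq T \<and> (\<Union>j. T j) = verts G \<and>
     (\<forall>j. flow_measure (G \<restriction> T j) (induced_root \<omega> (T j)) (\<mu> j)) \<and>
     (\<forall>x\<in>verts G. (\<lambda>j. if x \<in> T j then \<mu> j x else 0) \<longlonglongrightarrow> m x)"

end

theory Submission
  imports Defs
begin

text \<open>
  Choose a successor of every vertex. Every vertex \<open>l\<close> then lies on a two-sided infinite geodesic: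
  upwards follow predecessors, downwards follow chosen successors. The indicator function of
  such a geodesic is a flow on the whole tree, so a finite sum of such indicators with positive
  integer coefficients is an integer flow, bounded and supported exactly on a union of geodesics.
  The ratios of a bounded positive integer flow have a common denominator.

  Fix a vertex \<open>o\<close> and let \<open>L\<^sub>j\<close> be the finite set of the descendants, \<open>2j\<close> generations down, of the
  \<open>j\<close>-th ancestor of \<open>o\<close>. The tree \<open>T\<^sub>j\<close> is the union of the geodesics through \<open>L\<^sub>j\<close>, and \<open>m\<^sub>j\<close> gives
  the geodesic through \<open>l\<close> the mass \<open>m(l)\<close> rounded up to a multiple of \<open>1/N\<close>, with \<open>N\<close> large.
  Eventually every vertex \<open>x\<close> lies above \<open>L\<^sub>j\<close>, and then \<open>m(x)\<close> is the sum of the masses of the \<open>l\<close>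
  below it, so only the rounding error remains.
\<close>

subsection \<open>Geodesics to the root at infinity\<close>

text \<open>Cycles are lists of arcs, while the paths below are built as lists of vertices; picking
  an arc for each adjacent pair translates between the two.\<close>

lemma (in wf_digraph) awalk_through:
  assumes "vs \<noteq> []" "set vs \<subseteq> verts G" "successively (dominates G) vs"
  shows "\<exists>p. awalk (hd vs) p (last vs) \<and> awalk_verts (hd vs) p = vs"
  using assms
proof (induction vs rule: induct_list012)
  case (2 x)
  then show ?case by (intro exI[of _ "[]"]) (simp add: awalk_Nil_iff)
next
  case (3 x y zs)
  then obtain p where p: "awalk y p (last (y # zs))" "awalk_verts y p = y # zs" by auto
  from 3 obtain e where "e \<in> arcs G" "tail G e = x" "head G e = y"
    by (auto simp: arcs_ends_conv)
  with p show ?case by (intro exI[of _ "e # p"]) (auto simp: awalk_Cons_iff)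
qed simp

lemma cofinal_trans:
  fixes r s t :: "nat \<Rightarrow> 'c"
  assumes "\<forall>n. r (k + n) = s (l + n)" "\<forall>n. s (k' + n) = t (l' + n)"
  shows "\<exists>k l. \<forall>n. r (k + n) = t (l + n)"
proof (intro exI allI)
  fix n
  show "r (k + k' + n) = t (l' + l + n)"
    using assms(1)[rule_format, of "k' + n"] assms(2)[rule_format, of "l + n"]
    by (simp add: algebra_simps)
qed

section \<open>Rays of the end: closure properties and existence from every vertex\<close>

context tree_root_at_infinity
begin

lemma ex_root_ray: "\<exists>r\<in>rays G. \<omega> = {s \<in> rays G. \<exists>k l. \<forall>n. r (k + n) = s (l + n)}"
  using root_in_boundary unfolding boundary_def quotient_def cofinal_rays_def by auto

lemma root_ray_rays: "r \<in> \<omega> \<Longrightarrow> r \<in> rays G"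
  using ex_root_ray by auto

lemma root_rays_cofinal:
  assumes "r \<in> \<omega>" "s \<in> \<omega>"
  shows "\<exists>k l. \<forall>n. r (k + n) = s (l + n)"
proof -
  obtain t where t: "\<omega> = {s \<in> rays G. \<exists>k l. \<forall>n. t (k + n) = s (l + n)}"
    using ex_root_ray by auto
  from assms obtain k l k' l' where "\<forall>n. t (k + n) = r (l + n)" "\<forall>n. t (k' + n) = s (l' + n)"
    unfolding t by blast
  then show ?thesis by (intro cofinal_trans[of r l t k k' s l']) auto
qed

lemma root_rayI:
  assumes "r \<in> \<omega>" "s \<in> rays G" "\<forall>n. r (k + n) = s (l + n)"
  shows "s \<in> \<omega>"
proof -
  obtain t where t: "\<omega> = {s \<in> rays G. \<exists>k l. \<forall>n. t (k + n) = s (l + n)}"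
    using ex_root_ray by auto
  from assms(1) obtain k' l' where "\<forall>n. t (k' + n) = r (l' + n)"
    unfolding t by blast
  from cofinal_trans[OF this assms(3)] assms(2) show ?thesis unfolding t by blast
qed

lemma root_ray_drop:
  assumes "r \<in> \<omega>"
  shows "(\<lambda>n. r (k + n)) \<in> \<omega>"
  using root_ray_rays[OF assms]
  by (intro root_rayI[OF assms, of _ k 0]) (auto simp: rays_def intro!: injI dest: injD)

text \<open>Extends a geodesic backwards by an edge: a vertex off the ray preserves injectivity, and
  the tail is unchanged.\<close>

lemma root_ray_Cons:
  assumes "r \<in> \<omega>" "x \<notin> range r" "x \<rightarrow>\<^bsub>G\<^esub> r 0"
  shows "case_nat x r \<in> \<omega>"
proof (rule root_rayI[OF assms(1), of _ 0 1])
  have r: "inj r" "\<And>n. r n \<in> verts G" "\<And>n. r n \<rightarrow>\<^bsub>G\<^esub> r (Suc n)"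
    using root_ray_rays[OF assms(1)] by (auto simp: rays_def)
  have "inj (case_nat x r)"
    using r(1) assms(2) by (auto simp: inj_def split: nat.splits)
  moreover have "x \<in> verts G" using assms(3) by auto
  ultimately show "case_nat x r \<in> rays G"
    using r assms(3) by (auto simp: rays_def split: nat.splits)
qed auto

text \<open>Walk back along a path from \<open>x\<close> to a vertex of some ray of the end. Each
  step back either lands on the current ray, which is then cut there, or leaves it, and the ray is
  extended.\<close>

lemma ex_root_ray_from:
  assumes "x \<in> verts G"
  shows "\<exists>r\<in>\<omega>. r 0 = x"
proof -
  obtain r where r: "r \<in> \<omega>"
    using ex_root_ray by (auto intro: exI[of _ "0::nat"])
  then have r0: "r 0 \<in> verts G" using root_ray_rays by (force simp: rays_def)
  have "strongly_connected (with_proj (mk_symmetric G))"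
    using tree_connected by (simp add: Digraph_Component.connected_def)
  then have "x \<rightarrow>\<^sup>*\<^bsub>with_proj (mk_symmetric G)\<^esub> r 0"
    using assms r0 by auto
  then have "x \<rightarrow>\<^sup>* r 0"
    by (simp add: reachable_mk_symmetric_eq[OF sym_arcs])
  then show ?thesis
  proof (induction rule: converse_reachable_induct)
    case base
    then show ?case using r by auto
  next
    case (step x y)
    then obtain s where s: "s \<in> \<omega>" "s 0 = y" by auto
    show ?case
    proof (cases "x \<in> range s")
      case True
      then obtain k where "x = s k" by auto
      with root_ray_drop[OF s(1), of k] show ?thesis
        by (intro bexI[of _ "\<lambda>n. s (k + n)"]) auto
    next
      case False
      with root_ray_Cons[OF s(1)] s(2) step(1) show ?thesis by force
    qed
  qed
qed

text \<open>
  Two rays that leave a vertex through different edges and later meet again bound a cycle.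
\<close>

lemma root_ray_step_unique:
  assumes r: "r \<in> \<omega>" and s: "s \<in> \<omega>" and start: "r 0 = s 0"
  shows "r 1 = s 1"
proof (rule ccontr)
  assume neq: "r 1 \<noteq> s 1"
  have rr: "inj r" "range r \<subseteq> verts G" "\<And>n. r n \<rightarrow>\<^bsub>G\<^esub> r (Suc n)"
    using root_ray_rays[OF r] by (auto simp: rays_def)
  have ss: "inj s" "range s \<subseteq> verts G" "\<And>n. s n \<rightarrow>\<^bsub>G\<^esub> s (Suc n)"
    using root_ray_rays[OF s] by (auto simp: rays_def)
  obtain k l where kl: "\<And>n. r (k + n) = s (l + n)"
    using root_rays_cofinal[OF r s] by auto
  \<comment> \<open>The first return of \<open>r\<close> to \<open>s\<close>. The common tail
    provides a return; taking \<open>Suc k\<close> makes its index positive.\<close>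
  define a where "a = (LEAST i. i > 0 \<and> r i \<in> range s)"
  have "Suc k > 0 \<and> r (Suc k) \<in> range s" using kl[of 1] by auto
  then have a: "a > 0" "r a \<in> range s"
    unfolding a_def by (metis (mono_tags, lifting) LeastI)+
  have a_min: "r i \<notin> range s" if "0 < i" "i < a" for i
    using not_less_Least[of i] that unfolding a_def by blast
  obtain b where b: "r a = s b" using a by auto
  have "b > 0"
    using a b start rr(1) by (metis gr0I inj_eq not_gr_zero)
  have "\<not> (a = 1 \<and> b = 1)" using neq b by auto
  with a \<open>b > 0\<close> have ab: "a + b \<ge> 3" by auto
  \<comment> \<open>Out along \<open>r\<close> to just before the meeting point
    \<open>r a = s b\<close>, then back along \<open>s\<close> to the common start.\<close>
  define vs where "vs = map r [0..<a] @ map s (rev [0..<Suc b])"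
  have hd_vs: "hd vs = r 0" using a by (auto simp: vs_def hd_append hd_map)
  have last_vs: "last vs = s 0"
    by (simp add: vs_def last_map last_rev)
  have verts_vs: "set vs \<subseteq> verts G" using rr ss by (auto simp: vs_def)
  have "successively (dominates G) vs"
    unfolding vs_def successively_append_iff
  proof (intro conjI disjI2)
    show "successively (dominates G) (map r [0..<a])"
      using rr by (auto simp: successively_conv_nth)
    show "successively (dominates G) (map s (rev [0..<Suc b]))"
      unfolding rev_map[symmetric] successively_rev
      using ss graph_symmetric by (auto simp: successively_conv_nth simp del: upt_Suc)
    have "last (map r [0..<a]) = r (a - 1)" using a by (simp add: last_map)
    moreover have "hd (map s (rev [0..<Suc b])) = r a" using b by simp
    ultimately show "last (map r [0..<a]) \<rightarrow>\<^bsub>G\<^esub> hd (map s (rev [0..<Suc b]))"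
      using rr(3)[of "a - 1"] a by simp
  qed
  with awalk_through[of vs] verts_vs hd_vs last_vs start obtain p
    where p: "awalk (r 0) p (r 0)" "awalk_verts (r 0) p = vs"
    by (metis append_is_Nil_conv map_is_Nil_conv rev_is_Nil_conv upt_eq_Nil_conv vs_def less_nat_zero_code zero_less_Suc not_less)
  have len: "length p \<ge> 3"
  proof -
    have "Suc (length p) = length vs" using p(2) length_awalk_verts by metis
    then show ?thesis using ab by (simp add: vs_def)
  qed
  \<comment> \<open>A cycle needs distinct vertices once the first is dropped, since the closed walk
    repeats it at its end.\<close>
  have "tl vs = map r [1..<a] @ map s (rev [0..<Suc b])"
    using a by (simp add: vs_def map_tl[symmetric] tl_append upt_rec[of 0] del: upt_Suc)
  moreover have "distinct (map r [1..<a])" "distinct (map s (rev [0..<Suc b]))"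
    using inj_on_subset[OF rr(1) subset_UNIV] inj_on_subset[OF ss(1) subset_UNIV]
    by (simp_all add: distinct_map del: upt_Suc)
  moreover have "set (map r [1..<a]) \<inter> set (map s (rev [0..<Suc b])) = {}"
  proof (rule equals0I)
    fix x
    assume "x \<in> set (map r [1..<a]) \<inter> set (map s (rev [0..<Suc b]))"
    then have x: "x \<in> r ` {1..<a}" "x \<in> range s" by auto
    from x(1) obtain i where "x = r i" "0 < i" "i < a" by auto
    with a_min[of i] x(2) show False by simp
  qed
  ultimately have "distinct (tl vs)"
    by (simp only: distinct_append)
  with p len have "cycle p" by (auto simp: cycle_def)
  with len tree_acyclic show False by blast
qed

section \<open>The predecessor map and its orbits\<close>

lemma predecessor_root_ray:
  assumes "r \<in> \<omega>"
  shows "predecessor \<omega> (r n) = r (Suc n)"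
  unfolding predecessor_def
proof (rule the_equality)
  show "\<exists>s\<in>\<omega>. s 0 = r n \<and> s 1 = r (Suc n)"
    using root_ray_drop[OF assms, of n] by (intro bexI[of _ "\<lambda>i. r (n + i)"]) auto
next
  fix y
  assume "\<exists>s\<in>\<omega>. s 0 = r n \<and> s 1 = y"
  then show "y = r (Suc n)"
    using root_ray_step_unique[OF _ root_ray_drop[OF assms, of n]] by fastforce
qed

lemma funpow_predecessor_root_ray:
  assumes "r \<in> \<omega>"
  shows "(predecessor \<omega> ^^ n) (r 0) = r n"
  by (induction n) (simp_all add: predecessor_root_ray[OF assms])

text \<open>Turns facts on rays into facts on iterated predecessors: orbits are injective, and any
  two of them merge.\<close>

lemma predecessor_ray:
  assumes "x \<in> verts G"
  shows "(\<lambda>n. (predecessor \<omega> ^^ n) x) \<in> \<omega>"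
proof -
  obtain r where r: "r \<in> \<omega>" "r 0 = x" using ex_root_ray_from[OF assms] by auto
  then have "(\<lambda>n. (predecessor \<omega> ^^ n) x) = r"
    using funpow_predecessor_root_ray by auto
  with r show ?thesis by simp
qed

lemma adj_predecessor: "x \<in> verts G \<Longrightarrow> x \<rightarrow>\<^bsub>G\<^esub> predecessor \<omega> x"
  using root_ray_rays[OF predecessor_ray, of x]
  by (auto simp: rays_def dest: spec[of _ 0])

lemma funpow_predecessor_in_verts: "x \<in> verts G \<Longrightarrow> (predecessor \<omega> ^^ n) x \<in> verts G"
  using root_ray_rays[OF predecessor_ray, of x] by (auto simp: rays_def)

lemma predecessor_in_verts: "x \<in> verts G \<Longrightarrow> predecessor \<omega> x \<in> verts G"
  using funpow_predecessor_in_verts[of x 1] by simp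

lemma funpow_predecessor_inject:
  assumes "x \<in> verts G"
  shows "(predecessor \<omega> ^^ a) x = (predecessor \<omega> ^^ b) x \<longleftrightarrow> a = b"
  using root_ray_rays[OF predecessor_ray[OF assms]] by (auto simp: rays_def inj_def)

lemma funpow_predecessor_confluent:
  assumes "x \<in> verts G" "y \<in> verts G"
  shows "\<exists>k l. (predecessor \<omega> ^^ k) x = (predecessor \<omega> ^^ l) y"
  using root_rays_cofinal[OF predecessor_ray[OF assms(1)] predecessor_ray[OF assms(2)]]
  by (metis add_0_right)

text \<open>Compare \<open>y\<close> with the geodesic from \<open>x\<close>. If \<open>y\<close> is
  off it, prepending \<open>y\<close> gives a geodesic from \<open>y\<close> through
  \<open>x\<close>; if \<open>y\<close> is on it, passing from \<open>x\<close> straight to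
  \<open>y\<close> gives a geodesic from \<open>x\<close>. Uniqueness of the first step decides both
  cases.\<close>

lemma adj_cases:
  assumes "x \<rightarrow>\<^bsub>G\<^esub> y"
  shows "y = predecessor \<omega> x \<or> x = predecessor \<omega> y"
proof -
  have x: "x \<in> verts G" using assms by auto
  define s where "s = (\<lambda>n. (predecessor \<omega> ^^ n) x)"
  have s: "s \<in> \<omega>" "s 0 = x" using predecessor_ray[OF x] by (auto simp: s_def)
  show ?thesis
  proof (cases "y \<in> range s")
    case False
    then have "case_nat y s \<in> \<omega>"
      using root_ray_Cons s assms graph_symmetric by metis
    from predecessor_root_ray[OF this, of 0] s show ?thesis by simp
  next
    case True
    then obtain k where k: "y = s k" by auto
    have "x \<noteq> y" using assms no_loops by (auto simp: arcs_ends_conv)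
    then have "k > 0" using k s by (cases k) auto
    have inj: "inj s" using root_ray_rays[OF s(1)] by (auto simp: rays_def)
    have "x \<notin> range (\<lambda>n. s (k + n))"
      using \<open>k > 0\<close> s(2) inj by (metis add_is_0 imageE inj_eq not_gr_zero)
    then have "case_nat x (\<lambda>n. s (k + n)) \<in> \<omega>"
      using root_ray_Cons[OF root_ray_drop[OF s(1), of k]] assms k by simp
    from predecessor_root_ray[OF this, of 0] k show ?thesis by simp
  qed
qed

lemma successors_eq: "successors G \<omega> x = {y \<in> verts G. predecessor \<omega> y = x}"
proof (intro equalityI subsetI)
  fix y
  assume "y \<in> successors G \<omega> x"
  then show "y \<in> {y \<in> verts G. predecessor \<omega> y = x}"
    using adj_cases[of x y] by (auto simp: successors_def)
next
  fix y
  assume y: "y \<in> {y \<in> verts G. predecessor \<omega> y = x}"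
  then have "x \<rightarrow>\<^bsub>G\<^esub> y" using adj_predecessor graph_symmetric by auto
  \<comment> \<open>Otherwise \<open>y\<close> would be its own second ancestor.\<close>
  moreover have "y \<noteq> predecessor \<omega> x"
    using y funpow_predecessor_inject[of y 2 0] by (auto simp: numeral_2_eq_2)
  ultimately show "y \<in> successors G \<omega> x" by (auto simp: successors_def)
qed

lemma finite_successors: "finite (successors G \<omega> x)"
proof (cases "x \<in> verts G")
  case True
  then show ?thesis using tree_locally_finite by (auto simp: successors_def)
next
  case False
  then have "successors G \<omega> x = {}" using successors_eq[of x] predecessor_in_verts by auto
  then show ?thesis by simp
qed

subsection \<open>Structure induced on a predecessor-closed subtree\<close>

context
  fixes S
  assumes S: "p_subtree G \<omega> S"
begin

lemma p_subtree_in_verts: "x \<in> S \<Longrightarrow> x \<in> verts G"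
  using S by (auto simp: p_subtree_def)

lemma p_subtree_funpow: "x \<in> S \<Longrightarrow> (predecessor \<omega> ^^ n) x \<in> S"
  using S by (induction n) (auto simp: p_subtree_def)

text \<open>A ray of the end is the predecessor orbit of its first vertex, so it stays in
  \<open>S\<close> once it starts there.\<close>

lemma induced_root_eq: "induced_root \<omega> S = {r \<in> \<omega>. r 0 \<in> S}"
proof -
  have "r n \<in> S" if "r \<in> \<omega>" "r 0 \<in> S" for r n
    using p_subtree_funpow[OF that(2)] funpow_predecessor_root_ray[OF that(1)] by metis
  then show ?thesis by (auto simp: induced_root_def)
qed

lemma predecessor_induced_root: "x \<in> S \<Longrightarrow> predecessor (induced_root \<omega> S) x = predecessor \<omega> x"
  unfolding predecessor_def induced_root_eq by (rule arg_cong[of _ _ The]) auto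

lemma dominates_induce: "x \<rightarrow>\<^bsub>G \<restriction> S\<^esub> y \<longleftrightarrow> x \<in> S \<and> y \<in> S \<and> x \<rightarrow>\<^bsub>G\<^esub> y"
  by (auto simp: arcs_ends_conv image_iff)

lemma successors_induced:
  "x \<in> S \<Longrightarrow> successors (G \<restriction> S) (induced_root \<omega> S) x = successors G \<omega> x \<inter> S"
  by (auto simp: successors_def predecessor_induced_root dominates_induce)

lemma rays_induced: "rays (G \<restriction> S) = {r \<in> rays G. range r \<subseteq> S}"
  using p_subtree_in_verts by (auto simp: rays_def dominates_induce)

text \<open>Acyclicity and local finiteness pass to subgraphs; a single predecessor orbit makes
  \<open>S\<close> infinite, and the merging of orbits makes it connected.\<close>

lemma p_subtree_tree_root_at_infinity: "tree_root_at_infinity (G \<restriction> S) (induced_root \<omega> S)"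
proof -
  have sub: "S \<subseteq> verts G" using p_subtree_in_verts by auto
  have sg: "subgraph (G \<restriction> S) G" using subgraph_induce_subgraphI[OF sub] .
  interpret H: sym_digraph "G \<restriction> S"
    using induced_graph_imp_graph induced_induce[OF sub] by blast
  obtain o' where o: "o' \<in> S" using S by (auto simp: p_subtree_def)
  show ?thesis
  proof unfold_locales
    fix e1 e2
    assume "e1 \<in> arcs (G \<restriction> S)" "e2 \<in> arcs (G \<restriction> S)"
      "arc_to_ends (G \<restriction> S) e1 = arc_to_ends (G \<restriction> S) e2"
    then show "e1 = e2" using no_multi_arcs by auto
  next
    fix e
    assume "e \<in> arcs (G \<restriction> S)"
    then show "tail (G \<restriction> S) e \<noteq> head (G \<restriction> S) e" using no_loops by auto
  next
    have "inj (\<lambda>n. (predecessor \<omega> ^^ n) o')"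
      using funpow_predecessor_inject p_subtree_in_verts o by (auto simp: inj_def)
    then have "infinite (range (\<lambda>n. (predecessor \<omega> ^^ n) o'))"
      using finite_imageD infinite_UNIV_nat by blast
    moreover have "range (\<lambda>n. (predecessor \<omega> ^^ n) o') \<subseteq> S" using p_subtree_funpow o by auto
    ultimately show "infinite (verts (G \<restriction> S))" using finite_subset by auto
  next
    have up: "x \<rightarrow>\<^sup>*\<^bsub>G \<restriction> S\<^esub> (predecessor \<omega> ^^ n) x" if "x \<in> S" for x n
    proof (induction n)
      case 0
      then show ?case using that H.reachable_refl by auto
    next
      case (Suc n)
      have "(predecessor \<omega> ^^ n) x \<rightarrow>\<^bsub>G \<restriction> S\<^esub> (predecessor \<omega> ^^ Suc n) x"
        using p_subtree_funpow[OF that, of n] p_subtree_funpow[OF that, of "Suc n"]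
          adj_predecessor p_subtree_in_verts by (auto simp: dominates_induce)
      with Suc show ?case using H.reachable_adj_trans by blast
    qed
    have "x \<rightarrow>\<^sup>*\<^bsub>G \<restriction> S\<^esub> y" if xy: "x \<in> S" "y \<in> S" for x y
    proof -
      obtain k l where "(predecessor \<omega> ^^ k) x = (predecessor \<omega> ^^ l) y"
        using funpow_predecessor_confluent[OF p_subtree_in_verts[OF xy(1)] p_subtree_in_verts[OF xy(2)]]
        by blast
      then show ?thesis
        using H.reachable_trans[OF up[OF xy(1), of k]] H.symmetric_reachable'[OF up[OF xy(2), of l]]
        by simp
    qed
    then show "Digraph_Component.connected (G \<restriction> S)"
      unfolding Digraph_Component.connected_def
      using o by (intro strongly_connectedI)
        (auto simp: H.reachable_mk_symmetric_eq[OF H.sym_arcs])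
  next
    show "\<not> (\<exists>p. pre_digraph.cycle (G \<restriction> S) p \<and> 3 \<le> length p)"
      using subgraph_cycle[OF sg] tree_acyclic by blast
  next
    fix x
    assume "x \<in> verts (G \<restriction> S)"
    then have "finite {y. x \<rightarrow>\<^bsub>G\<^esub> y}" using tree_locally_finite p_subtree_in_verts by simp
    then show "finite {y. x \<rightarrow>\<^bsub>G \<restriction> S\<^esub> y}"
      by (rule rev_finite_subset) (auto simp: dominates_induce)
  next
    obtain r where r: "r \<in> \<omega>" "r 0 \<in> S"
      using ex_root_ray_from[of o'] o p_subtree_in_verts by auto
    then have "r \<in> induced_root \<omega> S" by (simp add: induced_root_eq)
    then have r': "r \<in> rays (G \<restriction> S)"
      using root_ray_rays by (auto simp: rays_induced induced_root_def)
    have "induced_root \<omega> S = cofinal_rays (G \<restriction> S) `` {r}"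
      using r' root_rays_cofinal[OF r(1)] root_rayI[OF r(1)] root_ray_rays
      by (auto simp: cofinal_rays_def rays_induced induced_root_def) 
    with r' show "induced_root \<omega> S \<in> boundary (G \<restriction> S)"
      by (auto simp: boundary_def quotient_def)
  qed
qed

end

end

subsection \<open>Integer flows carried by finitely many two-sided geodesics\<close>

locale tree_with_section = tree_root_at_infinity +
  fixes \<sigma> :: "'a \<Rightarrow> 'a"
  assumes section_in_verts: "x \<in> verts G \<Longrightarrow> \<sigma> x \<in> verts G"
    and predecessor_section: "x \<in> verts G \<Longrightarrow> predecessor \<omega> (\<sigma> x) = x"
begin

abbreviation pred :: "'a \<Rightarrow> 'a" where "pred \<equiv> predecessor \<omega>"

text \<open>For a vertex \<open>l\<close> the pairs \<open>(n, k)\<close> and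
  \<open>(n + 1, k + 1)\<close> name the same vertex. This redundancy avoids a case split between
  the parts above and below \<open>l\<close>.\<close>

definition geodesic :: "'a \<Rightarrow> 'a set" where
  "geodesic l = {(pred ^^ n) ((\<sigma> ^^ k) l) | n k. True}"

lemma funpow_section_in_verts: "x \<in> verts G \<Longrightarrow> (\<sigma> ^^ k) x \<in> verts G"
  by (induction k) (auto simp: section_in_verts)

lemma funpow_predecessor_section: "x \<in> verts G \<Longrightarrow> (pred ^^ k) ((\<sigma> ^^ k) x) = x"
proof (induction k)
  case (Suc k)
  then show ?case
    using predecessor_section[OF funpow_section_in_verts, of x k] by (simp add: funpow_swap1)
qed simp

lemma geodesic_subset_verts: "l \<in> verts G \<Longrightarrow> geodesic l \<subseteq> verts G"
  by (auto simp: geodesic_def intro: funpow_predecessor_in_verts funpow_section_in_verts)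

lemma predecessor_in_geodesic:
  assumes "x \<in> geodesic l"
  shows "pred x \<in> geodesic l"
proof -
  from assms obtain n k where "x = (pred ^^ n) ((\<sigma> ^^ k) l)" by (auto simp: geodesic_def)
  then have "pred x = (pred ^^ Suc n) ((\<sigma> ^^ k) l)" by simp
  then show ?thesis unfolding geodesic_def by blast
qed

text \<open>Lets two points of a geodesic be viewed as ancestors of one common vertex, far enough
  below.\<close>

lemma geodesic_from_below:
  assumes "l \<in> verts G"
  shows "(pred ^^ n) ((\<sigma> ^^ k) l) = (pred ^^ (n + i)) ((\<sigma> ^^ (k + i)) l)"
  using funpow_predecessor_section[OF funpow_section_in_verts[OF assms], of i k]
  by (simp add: funpow_add add.commute[of k])

lemma funpow_predecessor_in_geodesic: "(pred ^^ n) l \<in> geodesic l"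
proof -
  have "(pred ^^ n) l = (pred ^^ n) ((\<sigma> ^^ 0) l)" by simp
  then show ?thesis unfolding geodesic_def by blast
qed

lemma geodesic_section:
  assumes "l \<in> verts G"
  shows "geodesic (\<sigma> l) = geodesic l"
proof
  have "(pred ^^ n) ((\<sigma> ^^ k) (\<sigma> l)) = (pred ^^ n) ((\<sigma> ^^ Suc k) l)" for n k
    by (simp add: funpow_swap1)
  then show "geodesic (\<sigma> l) \<subseteq> geodesic l"
    unfolding geodesic_def by blast
next
  have "(pred ^^ n) ((\<sigma> ^^ k) l) = (pred ^^ Suc n) ((\<sigma> ^^ k) (\<sigma> l))" for n k
    using geodesic_from_below[OF assms, of n k 1] by (simp add: funpow_swap1)
  then show "geodesic l \<subseteq> geodesic (\<sigma> l)"
    unfolding geodesic_def by blast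
qed

text \<open>This is why the indicator of a geodesic is a flow. Two points of it are ancestors of a
  common vertex; if their predecessors agree, injectivity of the orbit puts them at the same
  height.\<close>

lemma geodesic_unique_successor:
  assumes l: "l \<in> verts G" and x: "x \<in> geodesic l"
  shows "\<exists>!y. y \<in> geodesic l \<and> pred y = x"
proof -
  from x obtain n k where "x = (pred ^^ n) ((\<sigma> ^^ k) l)" by (auto simp: geodesic_def)
  then have "pred ((pred ^^ n) ((\<sigma> ^^ Suc k) l)) = x"
    using geodesic_from_below[OF l, of n k 1] by simp
  moreover have "(pred ^^ n) ((\<sigma> ^^ Suc k) l) \<in> geodesic l"
    unfolding geodesic_def by blast
  moreover have "y = z"
    if y: "y \<in> geodesic l" and z: "z \<in> geodesic l" and eq: "pred y = pred z" for y z
  proof -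
    from y obtain a i where "y = (pred ^^ a) ((\<sigma> ^^ i) l)" by (auto simp: geodesic_def)
    moreover from z obtain b j where "z = (pred ^^ b) ((\<sigma> ^^ j) l)" by (auto simp: geodesic_def)
    ultimately have yz: "y = (pred ^^ (a + j)) ((\<sigma> ^^ (i + j)) l)"
      "z = (pred ^^ (b + i)) ((\<sigma> ^^ (i + j)) l)"
      using geodesic_from_below[OF l, of a i j] geodesic_from_below[OF l, of b j i]
      by (simp_all add: add.commute)
    from eq have "(pred ^^ Suc (a + j)) ((\<sigma> ^^ (i + j)) l) = (pred ^^ Suc (b + i)) ((\<sigma> ^^ (i + j)) l)"
      using yz by simp
    then have "a + j = b + i"
      using funpow_predecessor_inject[OF funpow_section_in_verts[OF l, of "i + j"]] by blast
    then show ?thesis using yz by simp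
  qed
  ultimately show ?thesis by metis
qed

section \<open>Superposition of finitely many geodesics\<close>

definition geodesics :: "'a set \<Rightarrow> 'a set" where
  "geodesics L = (\<Union>l\<in>L. geodesic l)"

definition geodesic_flow :: "'a set \<Rightarrow> ('a \<Rightarrow> nat) \<Rightarrow> 'a \<Rightarrow> nat" where
  "geodesic_flow L c x = (\<Sum>l\<in>L. if x \<in> geodesic l then c l else 0)"

text \<open>A point of the geodesic has exactly one successor on it; a point off it has none,
  because geodesics are closed under predecessors.\<close>

lemma sum_successors_geodesic:
  fixes c :: nat
  assumes "l \<in> verts G"
  shows "(\<Sum>y\<in>successors G \<omega> x. if y \<in> geodesic l then c else 0) = (if x \<in> geodesic l then c else 0)"
proof (cases "x \<in> geodesic l")
  case True
  from geodesic_unique_successor[OF assms True] obtain y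
    where y: "y \<in> geodesic l \<and> pred y = x"
      and unique: "\<forall>z. z \<in> geodesic l \<and> pred z = x \<longrightarrow> z = y"
    by (rule ex1E)
  have "{z \<in> successors G \<omega> x. z \<in> geodesic l} = {y}"
    using y unique geodesic_subset_verts[OF assms] unfolding successors_eq by blast
  with True show ?thesis by (simp add: sum.inter_filter[OF finite_successors, symmetric])
next
  case False
  then show ?thesis
    using predecessor_in_geodesic by (auto intro!: sum.neutral simp: successors_eq)
qed

lemma geodesic_flow_eq_sum_successors:
  assumes "L \<subseteq> verts G"
  shows "geodesic_flow L c x = (\<Sum>y\<in>successors G \<omega> x. geodesic_flow L c y)"
  unfolding geodesic_flow_def
  by (subst sum.swap, rule sum.cong) (use assms in \<open>auto simp: sum_successors_geodesic\<close>)

lemma geodesic_flow_eq_0: "x \<notin> geodesics L \<Longrightarrow> geodesic_flow L c x = 0"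
  by (auto simp: geodesic_flow_def geodesics_def intro!: sum.neutral)

lemma geodesic_flow_pos:
  assumes "finite L" "\<And>l. l \<in> L \<Longrightarrow> c l > 0" "x \<in> geodesics L"
  shows "geodesic_flow L c x > 0"
proof -
  from assms(3) obtain l where l: "l \<in> L" "x \<in> geodesic l" by (auto simp: geodesics_def)
  show ?thesis unfolding geodesic_flow_def
    by (rule sum_pos2[OF assms(1) l(1)]) (use l assms(2) in auto)
qed

text \<open>The bound is the same at all the infinitely many vertices, and so yields one common
  denominator.\<close>

lemma geodesic_flow_le: "geodesic_flow L c x \<le> sum c L"
  unfolding geodesic_flow_def by (rule sum_mono) auto

lemma p_subtree_geodesics:
  assumes "L \<subseteq> verts G" "L \<noteq> {}"
  shows "p_subtree G \<omega> (geodesics L)"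
  unfolding p_subtree_def geodesics_def
proof (intro conjI ballI)
  show "(\<Union>l\<in>L. geodesic l) \<subseteq> verts G"
    using assms(1) by (intro UN_least geodesic_subset_verts) auto
  from assms(2) obtain l where "l \<in> L" by auto
  with funpow_predecessor_in_geodesic[of 0 l] show "(\<Union>l\<in>L. geodesic l) \<noteq> {}" by auto
qed (auto intro: predecessor_in_geodesic)

lemma flow_measure_geodesic_flow:
  assumes L: "finite L" "L \<noteq> {}" "L \<subseteq> verts G" and c: "\<And>l. l \<in> L \<Longrightarrow> c l > 0"
    and N: "N > 0"
  shows "flow_measure (G \<restriction> geodesics L) (induced_root \<omega> (geodesics L))
    (\<lambda>x. real (geodesic_flow L c x) / real N)"
  unfolding flow_measure_def
proof (intro conjI ballI)
  fix x
  assume "x \<in> verts (G \<restriction> geodesics L)"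
  then have x: "x \<in> geodesics L" by simp
  show "real (geodesic_flow L c x) / real N > 0"
    using geodesic_flow_pos[OF L(1) c x] N by simp
  have "geodesic_flow L c x = (\<Sum>y\<in>successors G \<omega> x \<inter> geodesics L. geodesic_flow L c y)"
    unfolding geodesic_flow_eq_sum_successors[OF L(3), of c x]
    by (rule sum.mono_neutral_right) (auto simp: finite_successors geodesic_flow_eq_0)
  then show "real (geodesic_flow L c x) / real N =
      (\<Sum>y\<in>successors (G \<restriction> geodesics L) (induced_root \<omega> (geodesics L)) x.
         real (geodesic_flow L c y) / real N)"
    using successors_induced[OF p_subtree_geodesics[OF L(3,2)] x]
    by (simp add: sum_divide_distrib[symmetric])
qed

text \<open>
  A common denominator of the ratios is \<open>K!\<close>, where \<open>K\<close> bounds the integer flow.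
\<close>

lemma uniformly_rational_geodesic_flow:
  assumes L: "finite L" "L \<noteq> {}" "L \<subseteq> verts G" and c: "\<And>l. l \<in> L \<Longrightarrow> c l > 0"
    and N: "N > 0"
  shows "uniformly_rational (G \<restriction> geodesics L) (induced_root \<omega> (geodesics L))
    (\<lambda>x. real (geodesic_flow L c x) / real N)"
  unfolding uniformly_rational_def
proof (rule exI[of _ "fact (sum c L) :: nat"], intro conjI ballI)
  fix x
  assume "x \<in> verts (G \<restriction> geodesics L)"
  then have x: "x \<in> geodesics L" by simp
  let ?\<phi> = "geodesic_flow L c"
  have p: "pred x \<in> geodesics L"
    using x predecessor_in_geodesic by (auto simp: geodesics_def)
  have pos: "?\<phi> x > 0" "?\<phi> (pred x) > 0"
    using geodesic_flow_pos[OF L(1) c] x p by auto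
  \<comment> \<open>The value lies between 1 and \<open>sum c L\<close>, hence is a factor of the
    factorial.\<close>
  have "?\<phi> (pred x) dvd fact (sum c L)"
    using pos geodesic_flow_le[of L c] by (intro dvd_fact) (auto simp: Suc_le_eq)
  then obtain d where d: "fact (sum c L) = ?\<phi> (pred x) * d" by blast
  then have "d > 0" by (metis fact_nonzero mult_0_right not_gr_zero)
  have "real (fact (sum c L)) * (real (?\<phi> x) / real N) / (real (?\<phi> (pred x)) / real N) = real (d * ?\<phi> x)"
    using pos N by (simp only: d) (simp add: field_simps)
  then show "\<exists>k>0. real (fact (sum c L)) * (real (?\<phi> x) / real N) /
      (real (?\<phi> (predecessor (induced_root \<omega> (geodesics L)) x)) / real N) = real k"
    using \<open>d > 0\<close> pos predecessor_induced_root[OF p_subtree_geodesics[OF L(3,2)] x]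
    by (intro exI[of _ "d * ?\<phi> x"]) simp
qed simp

end

subsection \<open>Approximation of a flow\<close>

context flow_tree
begin

definition descendants :: "nat \<Rightarrow> 'a \<Rightarrow> 'a set" where
  "descendants n x = {y \<in> verts G. (predecessor \<omega> ^^ n) y = x}"

lemma descendants_Suc: "descendants (Suc n) x = (\<Union>y\<in>descendants n x. successors G \<omega> y)"
  using predecessor_in_verts
  by (auto simp: descendants_def successors_eq funpow_Suc_right simp del: funpow.simps(2))

lemma finite_descendants: "finite (descendants n x)"
proof (induction n)
  case 0
  have "descendants 0 x \<subseteq> {x}" by (auto simp: descendants_def)
  then show ?case using finite_subset by blast
next
  case (Suc n)
  then show ?case by (simp add: descendants_Suc finite_successors)
qed

text \<open>Iterates the flow equation over \<open>n\<close> generations; distinct vertices have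
  disjoint successor sets, so no mass is counted twice.\<close>

lemma flow_eq_sum_descendants:
  assumes "x \<in> verts G"
  shows "m x = (\<Sum>y\<in>descendants n x. m y)"
proof (induction n)
  case 0
  have "descendants 0 x = {x}" using assms by (auto simp: descendants_def)
  then show ?case by simp
next
  case (Suc n)
  have "(\<Sum>y\<in>descendants (Suc n) x. m y) = (\<Sum>y\<in>descendants n x. \<Sum>z\<in>successors G \<omega> y. m z)"
    unfolding descendants_Suc
    by (rule sum.UNION_disjoint)
      (simp_all add: finite_descendants finite_successors, auto simp: successors_eq)
  also have "\<dots> = (\<Sum>y\<in>descendants n x. m y)"
    using flow by (intro sum.cong) (auto simp: flow_measure_def descendants_def)
  finally show ?case using Suc by simp
qed

lemma ex_successor:
  assumes "x \<in> verts G"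
  shows "\<exists>y\<in>verts G. predecessor \<omega> y = x"
proof -
  have "successors G \<omega> x \<noteq> {}"
    using flow assms unfolding flow_measure_def by (metis less_irrefl sum.empty)
  then show ?thesis by (auto simp: successors_eq)
qed

end

locale flow_tree_with_section = flow_tree + tree_with_section
begin

section \<open>The approximating trees and measures\<close>

context
  fixes o' :: 'a
  assumes base: "o' \<in> verts G"
begin

text \<open>Climbing \<open>j\<close> and descending \<open>2 * j\<close> generations puts the
  leaves \<open>j\<close> levels below \<open>o'\<close>: as \<open>j\<close> grows, the top
  ancestor rises and the leaves sink.\<close>

definition leaves :: "nat \<Rightarrow> 'a set" where
  "leaves j = descendants (2 * j) ((pred ^^ j) o')"

text \<open>
  Rounding costs less than \<open>1 / denominator j\<close> per leaf, hence at most \<open>1 / (j + 1)\<close> in total.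
\<close>

definition denominator :: "nat \<Rightarrow> nat" where
  "denominator j = Suc j * card (leaves j)"

text \<open>Rounding up rather than down keeps every coefficient positive.\<close>

definition numerator :: "nat \<Rightarrow> 'a \<Rightarrow> nat" where
  "numerator j l = nat \<lceil>real (denominator j) * m l\<rceil>"

definition approximant :: "nat \<Rightarrow> 'a \<Rightarrow> real" where
  "approximant j x = real (geodesic_flow (leaves j) (numerator j) x) / real (denominator j)"

lemma leaves_finite: "finite (leaves j)"
  by (simp add: leaves_def finite_descendants)

lemma leaves_in_verts: "leaves j \<subseteq> verts G"
  by (auto simp: leaves_def descendants_def)

lemma descendants_nonempty: "x \<in> verts G \<Longrightarrow> descendants n x \<noteq> {}"
  using funpow_predecessor_section funpow_section_in_verts by (force simp: descendants_def)

lemma leaves_nonempty: "leaves j \<noteq> {}"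
  unfolding leaves_def by (intro descendants_nonempty funpow_predecessor_in_verts base)

lemma denominator_pos: "denominator j > 0"
  using leaves_nonempty leaves_finite by (simp add: denominator_def card_gt_0_iff)

lemma numerator_pos: "l \<in> leaves j \<Longrightarrow> numerator j l > 0"
  using leaves_in_verts[of j] flow denominator_pos[of j]
  by (auto simp: numerator_def flow_measure_def)

text \<open>\<open>\<sigma> l\<close> is one level below \<open>l\<close>, and its ancestor
  \<open>2 * j + 2\<close> generations up is the predecessor of the old top.\<close>

lemma leaves_section: "l \<in> leaves j \<Longrightarrow> \<sigma> l \<in> leaves (Suc j)"
  by (auto simp: leaves_def descendants_def section_in_verts predecessor_section
      funpow_swap1[of pred _ "\<sigma> _"])

lemma incseq_geodesics_leaves: "incseq (\<lambda>j. geodesics (leaves j))"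
proof (rule incseq_SucI, rule subsetI)
  fix j x
  assume "x \<in> geodesics (leaves j)"
  then obtain l where l: "l \<in> leaves j" "x \<in> geodesic l" by (auto simp: geodesics_def)
  have "x \<in> geodesic (\<sigma> l)"
    using l geodesic_section[OF subsetD[OF leaves_in_verts l(1)]] by simp
  with leaves_section[OF l(1)] show "x \<in> geodesics (leaves (Suc j))"
    by (auto simp: geodesics_def)
qed

text \<open>For large \<open>j\<close> the vertex \<open>x\<close> descends from the top ancestor
  and lies no lower than the leaves. Counting generations then shows that the geodesic through a
  leaf meets \<open>x\<close> only if the leaf descends from \<open>x\<close>.\<close>

lemma leaves_through:
  assumes x: "x \<in> verts G"
  shows "\<exists>J. \<forall>j\<ge>J. \<exists>n. {l \<in> leaves j. x \<in> geodesic l} = descendants n x"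
proof -
  obtain a b where ab: "(pred ^^ a) x = (pred ^^ b) o'"
    using funpow_predecessor_confluent[OF x base] by auto
  show ?thesis
  proof (rule exI[of _ "a + b"], intro allI impI)
    fix j
    assume j: "a + b \<le> j"
    \<comment> \<open>The numbers of generations from \<open>x\<close> up to the top ancestor and
      down to the leaves; \<open>a + b \<le> j\<close> keeps both subtractions exact.\<close>
    define d n where "d = j + a - b" and "n = j + b - a"
    have dn: "d + n = 2 * j" "d = (j - b) + a" using j by (auto simp: d_def n_def)
    have up: "(pred ^^ d) x = (pred ^^ j) o'"
    proof -
      have "(pred ^^ d) x = (pred ^^ (j - b)) ((pred ^^ b) o')"
        by (simp add: dn(2) funpow_add ab)
      also have "\<dots> = (pred ^^ ((j - b) + b)) o'" by (simp only: funpow_add comp_apply)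
      finally show ?thesis using j by simp
    qed
    have "{l \<in> leaves j. x \<in> geodesic l} = descendants n x"
    proof (intro equalityI subsetI)
      fix l
      assume l: "l \<in> descendants n x"
      then have "l \<in> verts G" "(pred ^^ n) l = x" by (auto simp: descendants_def)
      moreover have "(pred ^^ (2 * j)) l = (pred ^^ d) ((pred ^^ n) l)"
        by (simp only: dn(1)[symmetric] funpow_add comp_apply)
      ultimately show "l \<in> {l \<in> leaves j. x \<in> geodesic l}"
        using up funpow_predecessor_in_geodesic[of n l] by (simp add: leaves_def descendants_def)
    next
      fix l
      assume "l \<in> {l \<in> leaves j. x \<in> geodesic l}"
      then have l: "l \<in> verts G" "(pred ^^ (2 * j)) l = (pred ^^ j) o'" "x \<in> geodesic l"
        by (auto simp: leaves_def descendants_def)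
      from l(3) obtain c k where x_eq: "x = (pred ^^ c) ((\<sigma> ^^ k) l)"
        by (auto simp: geodesic_def)
      let ?z = "(\<sigma> ^^ k) l"
      have l_eq: "(pred ^^ k) ?z = l" by (rule funpow_predecessor_section[OF l(1)])
      \<comment> \<open>The top ancestor is reached from \<open>?z\<close> in two ways, through
        \<open>l\<close> and through \<open>x\<close>; comparing heights determines
        \<open>c\<close>.\<close>
      have "(pred ^^ (2 * j + k)) ?z = (pred ^^ (d + c)) ?z"
        using l(2) up by (simp add: funpow_add l_eq x_eq)
      then have "2 * j + k = d + c"
        using funpow_predecessor_inject[OF funpow_section_in_verts[OF l(1), of k]] by blast
      then have "c = n + k" using dn by linarith
      then have "x = (pred ^^ n) l" using x_eq by (simp add: funpow_add l_eq)
      then show "l \<in> descendants n x" using l by (simp add: descendants_def)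
    qed
    then show "\<exists>n. {l \<in> leaves j. x \<in> geodesic l} = descendants n x" by blast
  qed
qed

text \<open>The masses of the descendants of \<open>x\<close> sum to \<open>m x\<close>. Rounding
  each one up adds at most \<open>1 / denominator j\<close>, and there are at most
  \<open>card (leaves j)\<close> of them.\<close>

lemma approximant_bounds:
  assumes x: "x \<in> verts G" and eq: "{l \<in> leaves j. x \<in> geodesic l} = descendants n x"
  shows "m x \<le> approximant j x" "approximant j x \<le> m x + 1 / real (Suc j)"
proof -
  let ?D = "descendants n x" and ?N = "real (denominator j)"
  have N: "?N > 0" using denominator_pos by simp
  have flow_eq: "geodesic_flow (leaves j) (numerator j) x = (\<Sum>l\<in>?D. numerator j l)"
    unfolding geodesic_flow_def eq[symmetric] by (rule sum.inter_filter[OF leaves_finite, symmetric])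
  have num: "?N * m l \<le> real (numerator j l) \<and> real (numerator j l) \<le> ?N * m l + 1"
    if "l \<in> ?D" for l
  proof -
    have "m l > 0" using that flow by (auto simp: descendants_def flow_measure_def)
    \<comment> \<open>Positivity ensures that \<open>nat\<close> does not truncate the
      ceiling.\<close>
    then have "?N * m l > 0" using N by simp
    then show ?thesis unfolding numerator_def by linarith
  qed
  have "?N * m x = (\<Sum>l\<in>?D. ?N * m l)"
    by (simp add: flow_eq_sum_descendants[OF x, of n] sum_distrib_left)
  also have "\<dots> \<le> (\<Sum>l\<in>?D. real (numerator j l))"
    using num by (intro sum_mono) auto
  finally show "m x \<le> approximant j x"
    using N by (simp add: approximant_def flow_eq field_simps)
  have "(\<Sum>l\<in>?D. real (numerator j l)) \<le> (\<Sum>l\<in>?D. ?N * m l + 1)"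
    using num by (intro sum_mono) auto
  also have "\<dots> = ?N * m x + real (card ?D)"
    by (simp add: flow_eq_sum_descendants[OF x, of n] sum_distrib_left sum.distrib)
  also have "card ?D \<le> card (leaves j)"
    unfolding eq[symmetric] by (intro card_mono leaves_finite) auto
  finally have "approximant j x \<le> (?N * m x + real (card (leaves j))) / ?N"
    unfolding approximant_def flow_eq by (simp add: divide_right_mono)
  also have "\<dots> = m x + 1 / real (Suc j)"
    using N by (simp add: denominator_def field_simps)
  finally show "approximant j x \<le> m x + 1 / real (Suc j)" .
qed

section \<open>Convergence and exhaustion\<close>

lemma approximant_tendsto:
  assumes x: "x \<in> verts G"
  shows "(\<lambda>j. approximant j x) \<longlonglongrightarrow> m x"
proof -
  obtain J where J: "\<forall>j\<ge>J. \<exists>n. {l \<in> leaves j. x \<in> geodesic l} = descendants n x"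
    using leaves_through[OF x] by auto
  show ?thesis
  proof (rule tendsto_sandwich)
    show "\<forall>\<^sub>F j in sequentially. m x \<le> approximant j x"
      and "\<forall>\<^sub>F j in sequentially. approximant j x \<le> m x + 1 / real (Suc j)"
      using J approximant_bounds[OF x] unfolding eventually_sequentially by blast+
    show "(\<lambda>j. m x + 1 / real (Suc j)) \<longlonglongrightarrow> m x"
      using LIMSEQ_inverse_real_of_nat_add[of "m x"] by (simp add: inverse_eq_divide)
  qed simp
qed

text \<open>At a late stage the leaves whose geodesics pass through a given vertex are all its
  descendants of some generation, and there is at least one.\<close>

lemma Union_geodesics_leaves: "(\<Union>j. geodesics (leaves j)) = verts G"
proof (intro equalityI subsetI)
  fix x
  assume "x \<in> (\<Union>j. geodesics (leaves j))"
  then obtain j l where l: "l \<in> leaves j" "x \<in> geodesic l" by (auto simp: geodesics_def)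
  then show "x \<in> verts G"
    using geodesic_subset_verts[OF subsetD[OF leaves_in_verts l(1)]] by auto
next
  fix x
  assume x: "x \<in> verts G"
  then obtain j n where "{l \<in> leaves j. x \<in> geodesic l} = descendants n x"
    using leaves_through by blast
  then show "x \<in> (\<Union>j. geodesics (leaves j))"
    using descendants_nonempty[OF x, of n] unfolding geodesics_def by blast
qed

lemma approximating_sequence_geodesics:
  "approximating_sequence G \<omega> m (\<lambda>j. geodesics (leaves j)) approximant"
  unfolding approximating_sequence_def
proof (intro conjI allI ballI)
  fix j
  show "p_subtree G \<omega> (geodesics (leaves j))"
    by (rule p_subtree_geodesics[OF leaves_in_verts leaves_nonempty])
  show "flow_measure (G \<restriction> geodesics (leaves j)) (induced_root \<omega> (geodesics (leaves j))) (approximant j)"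
    unfolding approximant_def[abs_def]
    by (rule flow_measure_geodesic_flow[OF leaves_finite leaves_nonempty leaves_in_verts
          numerator_pos denominator_pos])
next
  fix x
  assume "x \<in> verts G"
  \<comment> \<open>Outside the tree the superposition already vanishes, so the extension by zero
    changes nothing.\<close>
  moreover have "(if x \<in> geodesics (leaves j) then approximant j x else 0) = approximant j x" for j
    by (simp add: approximant_def geodesic_flow_eq_0)
  ultimately show "(\<lambda>j. if x \<in> geodesics (leaves j) then approximant j x else 0) \<longlonglongrightarrow> m x"
    by (simp add: approximant_tendsto)
qed (fact incseq_geodesics_leaves Union_geodesics_leaves)+

lemma uniformly_rational_approximant:
  "uniformly_rational (G \<restriction> geodesics (leaves j)) (induced_root \<omega> (geodesics (leaves j))) (approximant j)"
  unfolding approximant_def[abs_def]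
  by (rule uniformly_rational_geodesic_flow[OF leaves_finite leaves_nonempty leaves_in_verts
        numerator_pos denominator_pos])

end

end

theorem corollary4p7:
  fixes G :: "('a, 'b) pre_digraph" and \<omega> :: "(nat \<Rightarrow> 'a) set" and m :: "'a \<Rightarrow> real"
  assumes "flow_tree G \<omega> m"
  shows "\<exists>T \<mu>. approximating_sequence G \<omega> m T \<mu> \<and>
           (\<forall>j. flow_tree (G \<restriction> T j) (induced_root \<omega> (T j)) (\<mu> j) \<and>
                uniformly_rational (G \<restriction> T j) (induced_root \<omega> (T j)) (\<mu> j))"
proof -
  interpret flow_tree G \<omega> m by fact
  obtain \<sigma> where \<sigma>: "\<And>x. x \<in> verts G \<Longrightarrow> \<sigma> x \<in> verts G \<and> predecessor \<omega> (\<sigma> x) = x"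
    using ex_successor by metis
  interpret flow_tree_with_section G \<omega> m \<sigma>
    by unfold_locales (use \<sigma> in auto)
  obtain o' where o: "o' \<in> verts G" using tree_infinite by (metis ex_in_conv finite.emptyI)
  let ?T = "\<lambda>j. geodesics (leaves o' j)" and ?\<mu> = "approximant o'"
  have approx: "approximating_sequence G \<omega> m ?T ?\<mu>"
    by (rule approximating_sequence_geodesics[OF o])
  have "flow_tree (G \<restriction> ?T j) (induced_root \<omega> (?T j)) (?\<mu> j)" for j
    using approx p_subtree_tree_root_at_infinity
    by (auto simp: approximating_sequence_def flow_tree_def flow_tree_axioms_def)
  with approx uniformly_rational_approximant[OF o] show ?thesis by blast
qed

end
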